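(* Let $\Gamma = \langle p,q,s \mid s^{-2}ps^{2}q\rangle$, which is isomorphic to the free group $\mathbb{F}_2$ of rank two, and let $X$ be the Cayley graph of $\Gamma$ with respect to the generating set $\{p,q,s\}$. Let $\mathfrak{L}$ be a $pq$-ladder in $X$, let $\gamma \in \partial_\infty X = \partial_\infty \Gamma$ be the boundary point corresponding to an end of $\mathfrak{L}$, let $x$ be a vertex contained in a side of $\mathfrak{L}$, and let $y$ be the middle vertex of a rung of $\mathfrak{L}$. Then the ray bundles $\mathcal{RB}(x,\gamma)$ and $\mathcal{RB}(y,\gamma)$ in $X$ have infinite symmetric difference.
   Context: Cayley graph: the vertices are the elements of $\Gamma$, and for each $g\in\Gamma$ and each generator $a\in\{p,q,s\}$ there is an edge labelled $a$ joining $g$ to $ga$. Edges have length $1$ and may be traversed in both directions; $X$ carries the path metric $d$. Geodesic rays and boundary: a geodesic ray from a vertex $v$ is a unit-speed infinite edge path $\rho:[0,\infty)\to X$ with $\rho(0)=v$, sending integers to vertices, with $d(\rho(m),\rho(n))=|m-n|$ for all integers $m,n\ge 0$. Two geodesic rays are equivalent if each is contained in an $R$-neighbourhood of the other for some $R\ge 0$. The Gromov boundary $\partial_\infty X$ is the set of equivalence classes. A ray goes to $\gamma\in\partial_\infty X$ if its class is $\gamma$. Ray bundle: for a vertex $v$ and $\gamma\in\partial_\infty X$, $\mathcal{RB}(v,\gamma)$ is the set of all vertices of $X$ lying on some geodesic ray from $v$ to $\gamma$. $pq$-ladders: in $\Gamma$ one has $p s^2 = s^2 q^{-1}$. A $pq$-ladder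 is a subgraph $\mathfrak{L}$ of $X$ obtained, for some $g\in\Gamma$, as the union of: the bi-infinite $p$-labelled line through the vertices $gp^n$, $n\in\mathbb{Z}$ (one side); the bi-infinite $q$-labelled line through the vertices $gp^ns^2 = gs^2q^{-n}$, $n\in\mathbb{Z}$ (the other side); and, for each $n\in\mathbb{Z}$, the length-two path labelled $ss$ with successive vertices $gp^n,\ gp^ns,\ gp^ns^2$ (the $n$-th rung, whose middle vertex is $gp^ns$). The two ends of $\mathfrak{L}$ correspond to the points of $\partial_\infty X$ represented by the rays along a side of $\mathfrak{L}$ (for instance through the vertices $gp^n$) as $n\to+\infty$ and as $n\to-\infty$. *)

theory Defs
  imports "HOL-Algebra.Coset" "Graph_Theory.Digraph_Component"
begin

section \<open>Groups given by a presentation\<close>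

text \<open>
  The letter \<open>(a, True)\<close> stands for the generator \<open>a\<close>, and \<open>(a, False)\<close> for its formal inverse.
  The generating set of a presentation is the whole type \<open>'a\<close>.
\<close>

type_synonym 'a word = "('a \<times> bool) list"

inductive pres_cong :: "'a word set \<Rightarrow> 'a word \<Rightarrow> 'a word \<Rightarrow> bool" for R where
  refl: "pres_cong R u u"
| sym: "pres_cong R u v \<Longrightarrow> pres_cong R v u"
| trans: "pres_cong R u v \<Longrightarrow> pres_cong R v w \<Longrightarrow> pres_cong R u w"
| cancel: "pres_cong R (u @ [(a, b), (a, \<not> b)] @ v) (u @ v)"
| relator: "r \<in> R \<Longrightarrow> pres_cong R (u @ r @ v) (u @ v)"

definition pres_rel :: "'a word set \<Rightarrow> 'a word rel" where
  "pres_rel R = {(u, v). pres_cong R u v}"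

definition word_class :: "'a word set \<Rightarrow> 'a word \<Rightarrow> 'a word set" where
  "word_class R w = pres_rel R `` {w}"

text \<open>
  The product of two classes is the class of the concatenation of any representatives, see
  \<open>word_class_mult\<close> below.
\<close>

definition presented_group :: "'a word set \<Rightarrow> 'a word set monoid" where
  "presented_group R =
    \<lparr>carrier = UNIV // pres_rel R,
     monoid.mult = (\<lambda>A B. \<Union>u\<in>A. \<Union>v\<in>B. word_class R (u @ v)),
     monoid.one = word_class R []\<rparr>"

abbreviation free_group_rank2 :: "bool word set monoid" where
  "free_group_rank2 \<equiv> presented_group {}"

lemma pres_cong_prefix: "pres_cong R u v \<Longrightarrow> pres_cong R (w @ u) (w @ v)"
proof (induction rule: pres_cong.induct)
  case (cancel u a b v)
  show ?case using pres_cong.cancel[of R "w @ u" a b v] by simp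
next
  case (relator r u v)
  then show ?case using pres_cong.relator[of r R "w @ u" v] by simp
qed (rule pres_cong.refl, erule pres_cong.sym, erule (1) pres_cong.trans)

lemma pres_cong_suffix: "pres_cong R u v \<Longrightarrow> pres_cong R (u @ w) (v @ w)"
proof (induction rule: pres_cong.induct)
  case (cancel u a b v)
  show ?case using pres_cong.cancel[of R u a b "v @ w"] by simp
next
  case (relator r u v)
  then show ?case using pres_cong.relator[of r R u "v @ w"] by simp
qed (rule pres_cong.refl, erule pres_cong.sym, erule (1) pres_cong.trans)

lemma pres_cong_append:
  "pres_cong R u u' \<Longrightarrow> pres_cong R v v' \<Longrightarrow> pres_cong R (u @ v) (u' @ v')"
  by (meson pres_cong.trans pres_cong_prefix pres_cong_suffix)

lemma word_class_eq_iff: "word_class R u = word_class R v \<longleftrightarrow> pres_cong R u v"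
  unfolding word_class_def pres_rel_def
  by (simp add: set_eq_iff) (meson pres_cong.refl pres_cong.sym pres_cong.trans)

lemma word_class_mult:
  "word_class R u \<otimes>\<^bsub>presented_group R\<^esub> word_class R v = word_class R (u @ v)"
proof -
  have *: "word_class R (u' @ v') = word_class R (u @ v)"
    if "u' \<in> word_class R u" "v' \<in> word_class R v" for u' v'
  proof -
    have "pres_cong R u u'" "pres_cong R v v'"
      using that by (simp_all add: word_class_def pres_rel_def)
    then show ?thesis
      unfolding word_class_eq_iff by (rule pres_cong.sym[OF pres_cong_append])
  qed
  have "u \<in> word_class R u" "v \<in> word_class R v"
    by (auto simp: word_class_def pres_rel_def intro: pres_cong.refl)
  then have ne: "word_class R u \<noteq> {}" "word_class R v \<noteq> {}"
    by blast+
  have "(\<Union>u'\<in>word_class R u. \<Union>v'\<in>word_class R v. word_class R (u' @ v')) =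
      (\<Union>u'\<in>word_class R u. \<Union>v'\<in>word_class R v. word_class R (u @ v))"
    by (intro SUP_cong HOL.refl *)
  also have "\<dots> = word_class R (u @ v)"
    using ne by simp
  finally show ?thesis
    by (simp add: presented_group_def)
qed

lemma carrier_presented_group: "carrier (presented_group R) = range (word_class R)"
  by (auto simp: presented_group_def word_class_def quotient_def)

lemma one_presented_group: "\<one>\<^bsub>presented_group R\<^esub> = word_class R []"
  by (simp add: presented_group_def)

lemma inverse_word: "pres_cong R (map (\<lambda>(a, b). (a, \<not> b)) (rev w) @ w) []"
proof (induction w)
  case Nil
  show ?case by (simp add: pres_cong.refl)
next
  case (Cons l w)
  obtain a b where l: "l = (a, b)" by (cases l)
  show ?case
    using pres_cong.trans[OF pres_cong.cancel[of R "map (\<lambda>(a, b). (a, \<not> b)) (rev w)" a "\<not> b" w] Cons.IH]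
    by (simp add: l)
qed

lemma group_presented_group: "group (presented_group R)"
proof (rule groupI)
  fix x assume "x \<in> carrier (presented_group R)"
  then obtain w where "x = word_class R w" by (auto simp: carrier_presented_group)
  then have "word_class R (map (\<lambda>(a, b). (a, \<not> b)) (rev w)) \<otimes>\<^bsub>presented_group R\<^esub> x
      = \<one>\<^bsub>presented_group R\<^esub>"
    by (simp add: word_class_mult one_presented_group word_class_eq_iff inverse_word)
  then show "\<exists>y\<in>carrier (presented_group R). y \<otimes>\<^bsub>presented_group R\<^esub> x = \<one>\<^bsub>presented_group R\<^esub>"
    by (auto simp: carrier_presented_group)
qed (auto simp: carrier_presented_group one_presented_group word_class_mult)

section \<open>Cayley graphs\<close>

text \<open>
  The arc \<open>(g, a)\<close> is the edge labelled \<open>a\<close> from \<open>g\<close> to \<open>g a\<close>. Since edges may be traversed in both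
  directions, adjacency is taken in \<open>mk_symmetric\<close>.
\<close>

definition cayley_graph :: "('g, 'm) monoid_scheme \<Rightarrow> ('a \<Rightarrow> 'g) \<Rightarrow> ('g, 'g \<times> 'a) pre_digraph" where
  "cayley_graph G f =
    \<lparr>verts = carrier G, arcs = carrier G \<times> UNIV, tail = fst, head = (\<lambda>(g, a). g \<otimes>\<^bsub>G\<^esub> f a)\<rparr>"

abbreviation adj :: "('v, 'e) pre_digraph \<Rightarrow> 'v rel" where
  "adj X \<equiv> parcs (mk_symmetric X)"

section \<open>Geodesic rays, boundary and ray bundles\<close>

text \<open>
  The path metric, restricted to vertices; only meaningful for connected graphs.
\<close>

definition graph_dist :: "('v, 'e) pre_digraph \<Rightarrow> 'v \<Rightarrow> 'v \<Rightarrow> nat" where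
  "graph_dist X u v = (LEAST n. (u, v) \<in> adj X ^^ n)"

text \<open>
  A unit-speed edge path is encoded by the sequence of vertices it visits at integer times. This
  determines the path if there are no multiple edges, which is the case for the Cayley graph
  considered below. Passing to integer times changes the radius of a neighbourhood by at most
  a constant, so it does not affect the equivalence of rays.
\<close>

definition geodesic_ray :: "('v, 'e) pre_digraph \<Rightarrow> 'v \<Rightarrow> (nat \<Rightarrow> 'v) \<Rightarrow> bool" where
  "geodesic_ray X v \<rho> \<longleftrightarrow>
    v \<in> verts X \<and> \<rho> 0 = v \<and> (\<forall>n. (\<rho> n, \<rho> (Suc n)) \<in> adj X) \<and>
    (\<forall>m n. int (graph_dist X (\<rho> m) (\<rho> n)) = \<bar>int m - int n\<bar>)"

definition geodesic_rays :: "('v, 'e) pre_digraph \<Rightarrow> (nat \<Rightarrow> 'v) set" where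
  "geodesic_rays X = {\<rho>. \<exists>v. geodesic_ray X v \<rho>}"

definition ray_equiv :: "('v, 'e) pre_digraph \<Rightarrow> (nat \<Rightarrow> 'v) rel" where
  "ray_equiv X = {(\<rho>, \<sigma>). \<rho> \<in> geodesic_rays X \<and> \<sigma> \<in> geodesic_rays X \<and>
    (\<exists>R. (\<forall>m. \<exists>n. graph_dist X (\<rho> m) (\<sigma> n) \<le> R) \<and> (\<forall>n. \<exists>m. graph_dist X (\<sigma> n) (\<rho> m) \<le> R))}"

definition gromov_boundary :: "('v, 'e) pre_digraph \<Rightarrow> (nat \<Rightarrow> 'v) set set" where
  "gromov_boundary X = geodesic_rays X // ray_equiv X"

definition ray_bundle :: "('v, 'e) pre_digraph \<Rightarrow> 'v \<Rightarrow> (nat \<Rightarrow> 'v) set \<Rightarrow> 'v set" where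
  "ray_bundle X v \<gamma> = {\<rho> n | \<rho> n. geodesic_ray X v \<rho> \<and> \<rho> \<in> \<gamma>}"

section \<open>The group $\langle p, q, s \mid s^{-2} p s^2 q\rangle$ and its ladders\<close>

datatype gen = P | Q | S

type_synonym elt = "gen word set"

definition pq_relators :: "gen word set" where
  "pq_relators = {[(S, False), (S, False), (P, True), (S, True), (S, True), (Q, True)]}"

definition \<Gamma> :: "elt monoid" where
  "\<Gamma> = presented_group pq_relators"

definition gen_elt :: "gen \<Rightarrow> elt" where
  "gen_elt a = word_class pq_relators [(a, True)]"

abbreviation "p \<equiv> gen_elt P"
abbreviation "q \<equiv> gen_elt Q"
abbreviation "s \<equiv> gen_elt S"

type_synonym pqs_graph = "(elt, elt \<times> gen) pre_digraph"

definition X :: pqs_graph where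
  "X = cayley_graph \<Gamma> gen_elt"

definition part_of_X :: "elt set \<Rightarrow> (elt \<times> gen) set \<Rightarrow> pqs_graph" where
  "part_of_X V A = \<lparr>verts = V, arcs = A, tail = tail X, head = head X\<rparr>"

abbreviation p_vertex :: "elt \<Rightarrow> int \<Rightarrow> elt" where
  "p_vertex g n \<equiv> g \<otimes>\<^bsub>\<Gamma>\<^esub> p [^]\<^bsub>\<Gamma>\<^esub> n"

abbreviation mid_vertex :: "elt \<Rightarrow> int \<Rightarrow> elt" where
  "mid_vertex g n \<equiv> p_vertex g n \<otimes>\<^bsub>\<Gamma>\<^esub> s"

abbreviation q_vertex :: "elt \<Rightarrow> int \<Rightarrow> elt" where
  "q_vertex g n \<equiv> mid_vertex g n \<otimes>\<^bsub>\<Gamma>\<^esub> s"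

text \<open>
  \<open>q_vertex g n\<close> is $g p^n s^2 = g s^2 q^{-n}$, so the arcs of the \<open>q\<close>-side point towards decreasing \<open>n\<close>
  (\<open>q_vertex_q\<close> below).
\<close>

definition p_side :: "elt \<Rightarrow> pqs_graph" where
  "p_side g = part_of_X (range (p_vertex g)) {(p_vertex g n, P) | n. True}"

definition q_side :: "elt \<Rightarrow> pqs_graph" where
  "q_side g = part_of_X (range (q_vertex g)) {(q_vertex g n, Q) | n. True}"

definition rung :: "elt \<Rightarrow> int \<Rightarrow> pqs_graph" where
  "rung g n = part_of_X {p_vertex g n, mid_vertex g n, q_vertex g n}
    {(p_vertex g n, S), (mid_vertex g n, S)}"

definition ladder :: "elt \<Rightarrow> pqs_graph" where
  "ladder g = union (union (p_side g) (q_side g)) (pre_digraph.Union X (range (rung g)))"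

text \<open>
  The base point of a ladder is determined only up to translation \<open>g \<mapsto> g p^k\<close>, so sides, rung middles
  and ends are notions of the subgraph \<open>L\<close>, obtained from any base point describing it.
\<close>

definition is_pq_ladder :: "pqs_graph \<Rightarrow> bool" where
  "is_pq_ladder L \<longleftrightarrow> (\<exists>g\<in>carrier \<Gamma>. L = ladder g)"

definition is_side_of :: "pqs_graph \<Rightarrow> pqs_graph \<Rightarrow> bool" where
  "is_side_of M L \<longleftrightarrow> (\<exists>g\<in>carrier \<Gamma>. L = ladder g \<and> (M = p_side g \<or> M = q_side g))"

definition is_rung_middle_of :: "elt \<Rightarrow> pqs_graph \<Rightarrow> bool" where
  "is_rung_middle_of y L \<longleftrightarrow> (\<exists>g\<in>carrier \<Gamma>. \<exists>n. L = ladder g \<and> y = mid_vertex g n)"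

text \<open>
  Rays along the \<open>q\<close>-side stay at distance at most 2 from those along the \<open>p\<close>-side, and hence represent the same
  boundary points.
\<close>

definition is_end_of :: "(nat \<Rightarrow> elt) set \<Rightarrow> pqs_graph \<Rightarrow> bool" where
  "is_end_of \<gamma> L \<longleftrightarrow> \<gamma> \<in> gromov_boundary X \<and> (\<exists>g\<in>carrier \<Gamma>. L = ladder g \<and>
    ((\<lambda>n. p_vertex g (int n)) \<in> \<gamma> \<or> (\<lambda>n. p_vertex g (- int n)) \<in> \<gamma>))"

lemma group_\<Gamma>: "group \<Gamma>"
  by (simp add: \<Gamma>_def group_presented_group)

lemma gen_elt_carrier: "gen_elt a \<in> carrier \<Gamma>"
  by (simp add: \<Gamma>_def gen_elt_def carrier_presented_group)

lemma \<Gamma>_relation: "inv\<^bsub>\<Gamma>\<^esub> s \<otimes>\<^bsub>\<Gamma>\<^esub> inv\<^bsub>\<Gamma>\<^esub> s \<otimes>\<^bsub>\<Gamma>\<^esub> p \<otimes>\<^bsub>\<Gamma>\<^esub> s \<otimes>\<^bsub>\<Gamma>\<^esub> s \<otimes>\<^bsub>\<Gamma>\<^esub> q = \<one>\<^bsub>\<Gamma>\<^esub>"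
proof -
  let ?t = "word_class pq_relators [(S, False)]"
  have "?t \<otimes>\<^bsub>\<Gamma>\<^esub> s = \<one>\<^bsub>\<Gamma>\<^esub>"
    using pres_cong.cancel[of pq_relators "[]" S False "[]"]
    by (simp add: \<Gamma>_def gen_elt_def word_class_mult one_presented_group word_class_eq_iff)
  moreover have "?t \<in> carrier \<Gamma>"
    by (simp add: \<Gamma>_def carrier_presented_group)
  ultimately have "inv\<^bsub>\<Gamma>\<^esub> s = ?t"
    using group.inv_equality[OF group_\<Gamma>] gen_elt_carrier by blast
  moreover have "pres_cong pq_relators
      [(S, False), (S, False), (P, True), (S, True), (S, True), (Q, True)] []"
    using pres_cong.relator[of _ pq_relators "[]" "[]"] by (simp add: pq_relators_def)
  ultimately show ?thesis
    by (simp add: \<Gamma>_def gen_elt_def word_class_mult one_presented_group word_class_eq_iff)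
qed

lemma p_s_s: "p \<otimes>\<^bsub>\<Gamma>\<^esub> s \<otimes>\<^bsub>\<Gamma>\<^esub> s = s \<otimes>\<^bsub>\<Gamma>\<^esub> s \<otimes>\<^bsub>\<Gamma>\<^esub> inv\<^bsub>\<Gamma>\<^esub> q"
proof -
  interpret group \<Gamma> by (rule group_\<Gamma>)
  have [simp]: "gen_elt a \<in> carrier \<Gamma>" for a by (rule gen_elt_carrier)
  have "inv\<^bsub>\<Gamma>\<^esub> (s \<otimes>\<^bsub>\<Gamma>\<^esub> s) \<otimes>\<^bsub>\<Gamma>\<^esub> (p \<otimes>\<^bsub>\<Gamma>\<^esub> s \<otimes>\<^bsub>\<Gamma>\<^esub> s) \<otimes>\<^bsub>\<Gamma>\<^esub> q = \<one>\<^bsub>\<Gamma>\<^esub>"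
    using \<Gamma>_relation by (simp add: inv_mult_group m_assoc)
  then have "inv\<^bsub>\<Gamma>\<^esub> (s \<otimes>\<^bsub>\<Gamma>\<^esub> s) \<otimes>\<^bsub>\<Gamma>\<^esub> (p \<otimes>\<^bsub>\<Gamma>\<^esub> s \<otimes>\<^bsub>\<Gamma>\<^esub> s) = inv\<^bsub>\<Gamma>\<^esub> q"
    by (metis inv_equality inv_inv gen_elt_carrier m_closed inv_closed)
  then show ?thesis
    by (simp add: inv_solve_left' m_assoc)
qed

lemma wf_X: "wf_digraph X"
  using group.is_monoid[OF group_\<Gamma>] gen_elt_carrier
  by unfold_locales (auto simp: X_def cayley_graph_def monoid.m_closed)

lemma q_vertex_q:
  assumes "g \<in> carrier \<Gamma>"
  shows "q_vertex g n \<otimes>\<^bsub>\<Gamma>\<^esub> q = q_vertex g (n - 1)"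
proof -
  interpret group \<Gamma> by (rule group_\<Gamma>)
  have [simp]: "gen_elt a \<in> carrier \<Gamma>" for a by (rule gen_elt_carrier)
  have "p [^]\<^bsub>\<Gamma>\<^esub> n = p [^]\<^bsub>\<Gamma>\<^esub> (n - 1) \<otimes>\<^bsub>\<Gamma>\<^esub> p"
    using int_pow_mult[of p "n - 1" 1] by (simp add: int_pow_1)
  then have "q_vertex g n \<otimes>\<^bsub>\<Gamma>\<^esub> q = g \<otimes>\<^bsub>\<Gamma>\<^esub> p [^]\<^bsub>\<Gamma>\<^esub> (n - 1) \<otimes>\<^bsub>\<Gamma>\<^esub> (p \<otimes>\<^bsub>\<Gamma>\<^esub> s \<otimes>\<^bsub>\<Gamma>\<^esub> s) \<otimes>\<^bsub>\<Gamma>\<^esub> q"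
    using assms by (simp add: m_assoc)
  also have "\<dots> = q_vertex g (n - 1)"
    using assms unfolding p_s_s by (simp add: m_assoc)
  finally show ?thesis .
qed

lemma subgraph_ladder:
  assumes "g \<in> carrier \<Gamma>"
  shows "subgraph (ladder g) X"
proof -
  interpret group \<Gamma> by (rule group_\<Gamma>)
  have [simp]: "gen_elt a \<in> carrier \<Gamma>" for a by (rule gen_elt_carrier)
  have p_step: "p_vertex g n \<otimes>\<^bsub>\<Gamma>\<^esub> p = p_vertex g (n + 1)" for n
    using assms int_pow_mult[of p n 1] by (simp add: int_pow_1 m_assoc)
  have defs: "tail (ladder g) = fst" "head (ladder g) = (\<lambda>(h, a). h \<otimes>\<^bsub>\<Gamma>\<^esub> gen_elt a)"
    "verts (ladder g) = range (p_vertex g) \<union> range (q_vertex g) \<union> range (mid_vertex g)"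
    "arcs (ladder g) = {(p_vertex g n, P) | n. True} \<union> {(q_vertex g n, Q) | n. True}
      \<union> {(p_vertex g n, S) | n. True} \<union> {(mid_vertex g n, S) | n. True}"
    by (auto simp: ladder_def union_def pre_digraph.Union_def p_side_def q_side_def rung_def
        part_of_X_def X_def cayley_graph_def)
  show ?thesis
    unfolding subgraph_def
  proof (intro conjI wf_X)
    show "wf_digraph (ladder g)"
      by unfold_locales (auto simp: defs p_step q_vertex_q[OF assms])
  qed (use assms in \<open>auto simp: defs compatible_def X_def cayley_graph_def\<close>)
qed

end

theory Submission
  imports Defs
begin

text \<open>
  The relation rewrites $q$ as $s^{-2} p^{-1} s^2$, so \<open>\<Gamma>\<close> is free on $p, s$. Write an element of
  \<open>\<Gamma>\<close>, relative to the base point of the ladder, as a reduced word $p^k s^e \cdots$ in this basis.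
  Sending it to column $\max(0, \min(2, e))$ of rung $k$ retracts \<open>X\<close> onto the ladder without
  increasing distances, and $k$ changes only along edges of the two sides. Hence distances within
  the ladder are distances in \<open>X\<close>, and a ray to an end of the ladder keeps meeting its sides.

  From a vertex on one side, a ray to the end may follow this side, cross an arbitrary rung and
  continue on the other side, so the ray bundle contains the middle vertices of all rungs further on.
  A path from the middle of one rung to the middle of another one has already crossed half a rung
  twice before it returns to a side, and is therefore two steps longer than a geodesic. So the ray
  bundle of a middle vertex contains no other middle vertex.
\<close>

section \<open>Letters as group elements\<close>

interpretation \<Gamma>: group \<Gamma>
  by (rule group_\<Gamma>)

lemma gen_closed [simp]: "gen_elt a \<in> carrier \<Gamma>"
  by (rule gen_elt_carrier)

lemma class_closed [simp]: "word_class pq_relators w \<in> carrier \<Gamma>"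
  by (simp add: \<Gamma>_def carrier_presented_group)

definition letter :: "gen \<times> bool \<Rightarrow> elt" where
  "letter l = word_class pq_relators [l]"

lemma letter_closed [simp]: "letter l \<in> carrier \<Gamma>"
  by (simp add: letter_def)

lemma letter_True: "letter (a, True) = gen_elt a"
  by (simp add: letter_def gen_elt_def)

lemma letter_cancel: "letter (a, b) \<otimes>\<^bsub>\<Gamma>\<^esub> letter (a, \<not> b) = \<one>\<^bsub>\<Gamma>\<^esub>"
  using pres_cong.cancel[of pq_relators "[]" a b "[]"]
  by (simp add: \<Gamma>_def letter_def word_class_mult one_presented_group word_class_eq_iff)

lemma letter_Not: "letter (a, \<not> b) = inv\<^bsub>\<Gamma>\<^esub> letter (a, b)"
  using letter_cancel[of a "\<not> b"] \<Gamma>.inv_equality[of "letter (a, \<not> b)" "letter (a, b)"] by simp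

lemma letter_False: "letter (a, False) = inv\<^bsub>\<Gamma>\<^esub> gen_elt a"
  using letter_Not[of a True] by (simp add: letter_True)

lemma word_class_snoc:
  "word_class pq_relators (w @ [l]) = word_class pq_relators w \<otimes>\<^bsub>\<Gamma>\<^esub> letter l"
  by (simp add: letter_def \<Gamma>_def word_class_mult)

lemma \<Gamma>_cases:
  assumes "x \<in> carrier \<Gamma>"
  obtains w where "x = word_class pq_relators w"
  using assms by (auto simp: \<Gamma>_def carrier_presented_group)

text \<open>The relator solved for q, for both signs at once; this is how q is eliminated in favour
  of the basis p, s.\<close>

lemma letter_Q:
  "letter (Q, b) = letter (S, False) \<otimes>\<^bsub>\<Gamma>\<^esub> letter (S, False) \<otimes>\<^bsub>\<Gamma>\<^esub> letter (P, \<not> b)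
    \<otimes>\<^bsub>\<Gamma>\<^esub> letter (S, True) \<otimes>\<^bsub>\<Gamma>\<^esub> letter (S, True)"
proof -
  let ?c = "inv\<^bsub>\<Gamma>\<^esub> s \<otimes>\<^bsub>\<Gamma>\<^esub> inv\<^bsub>\<Gamma>\<^esub> s \<otimes>\<^bsub>\<Gamma>\<^esub> p \<otimes>\<^bsub>\<Gamma>\<^esub> s \<otimes>\<^bsub>\<Gamma>\<^esub> s"
  have "inv\<^bsub>\<Gamma>\<^esub> q = ?c"
    using \<Gamma>_relation by (intro \<Gamma>.inv_equality) auto
  moreover from this have "q = inv\<^bsub>\<Gamma>\<^esub> ?c"
    by (metis \<Gamma>.inv_inv gen_closed)
  ultimately show ?thesis
    by (cases b) (simp_all add: letter_True letter_False \<Gamma>.inv_mult_group \<Gamma>.m_assoc)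
qed

section \<open>Freeness\<close>

text \<open>The Tietze move that eliminates q: \<open>True\<close> codes p, \<open>False\<close>
  codes s, and letters of q are rewritten as in \<open>letter_Q\<close>.\<close>

definition to_basis :: "gen word \<Rightarrow> bool word" where
  "to_basis = concat \<circ> map (\<lambda>(a, b). case a of P \<Rightarrow> [(True, b)] | S \<Rightarrow> [(False, b)]
     | Q \<Rightarrow> [(False, False), (False, False), (True, \<not> b), (False, True), (False, True)])"

definition of_basis :: "bool word \<Rightarrow> gen word" where
  "of_basis = map (\<lambda>(a, b). (if a then P else S, b))"

lemma to_basis_append: "to_basis (u @ v) = to_basis u @ to_basis v"
  by (simp add: to_basis_def)

lemma of_basis_append: "of_basis (u @ v) = of_basis u @ of_basis v"
  by (simp add: of_basis_def)

lemma to_basis_of_basis: "to_basis (of_basis w) = w"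
  by (induction w) (auto simp: to_basis_def of_basis_def)

lemma pres_cong_cancel_all:
  "pres_cong R (w @ map (\<lambda>(a, b). (a, \<not> b)) (rev w)) []"
proof -
  have "map (\<lambda>(a, b). (a, \<not> b)) (rev (map (\<lambda>(a, b). (a, \<not> b)) (rev w))) = w"
    by (induction w) auto
  then show ?thesis
    using inverse_word[of R "map (\<lambda>(a, b). (a, \<not> b)) (rev w)"] by simp
qed

lemma pres_cong_insert:
  "pres_cong R w [] \<Longrightarrow> pres_cong R (u @ w @ v) (u @ v)"
  using pres_cong_prefix[OF pres_cong_suffix, of R w "[]" u v] by simp

lemma pres_cong_to_basis:
  "pres_cong pq_relators u v \<Longrightarrow> pres_cong {} (to_basis u) (to_basis v)"
proof (induction rule: pres_cong.induct)
  case (cancel u a b v)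
  have "pres_cong {} (to_basis [(a, b), (a, \<not> b)]) []"
    using pres_cong_cancel_all[of "{}" "to_basis [(a, b)]"]
    by (cases a; cases b) (simp_all add: to_basis_def)
  from pres_cong_insert[OF this, of "to_basis u" "to_basis v"] show ?case
    by (simp only: to_basis_append)
next
  case (relator r u v)
  let ?w = "[(False, False), (False, False), (True, True), (False, True), (False, True)]"
  \<comment> \<open>The image s^-2 p^-1 s^2 of the final q is the formal inverse of the image s^-2 p
    s^2 of the letters before it.\<close>
  have "to_basis r = ?w @ map (\<lambda>(a, b). (a, \<not> b)) (rev ?w)"
    using relator by (simp add: pq_relators_def to_basis_def)
  then have "pres_cong {} (to_basis r) []"
    by (metis pres_cong_cancel_all)
  from pres_cong_insert[OF this, of "to_basis u" "to_basis v"] show ?case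
    by (simp only: to_basis_append)
qed (rule pres_cong.refl, erule pres_cong.sym, erule (1) pres_cong.trans)

lemma pres_cong_of_basis: "pres_cong {} u v \<Longrightarrow> pres_cong pq_relators (of_basis u) (of_basis v)"
proof (induction rule: pres_cong.induct)
  case (cancel u a b v)
  then show ?case
    using pres_cong.cancel[of pq_relators "of_basis u" "if a then P else S" b "of_basis v"]
    by (simp add: of_basis_def)
qed (rule pres_cong.refl, erule pres_cong.sym, erule (1) pres_cong.trans, simp)

lemma of_basis_to_basis: "word_class pq_relators (of_basis (to_basis w)) = word_class pq_relators w"
proof (induction w rule: rev_induct)
  case Nil
  show ?case by (simp add: to_basis_def of_basis_def)
next
  case (snoc l w)
  obtain a b where l: "l = (a, b)" by (cases l)
  have "word_class pq_relators (of_basis (to_basis [l])) = letter l"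
    using letter_Q[of b]
    by (cases a) (simp_all add: l letter_def to_basis_def of_basis_def \<Gamma>_def word_class_mult)
  then show ?case
    using snoc by (simp add: to_basis_append of_basis_append \<Gamma>_def letter_def flip: word_class_mult)
qed

lemma \<Gamma>_iso_free_group: "\<Gamma> \<cong> free_group_rank2"
proof -
  \<comment> \<open>The choice of representative is harmless, since congruent words have congruent
    translations in both directions.\<close>
  define \<phi> where "\<phi> A = word_class {} (to_basis (SOME w. A = word_class pq_relators w))" for A
  define \<psi> where "\<psi> A = word_class pq_relators (of_basis (SOME w. A = word_class {} w))"
    for A :: "bool word set"
  have \<phi>: "\<phi> (word_class pq_relators w) = word_class {} (to_basis w)" for w
    unfolding \<phi>_def word_class_eq_iff
    by (rule someI2[of _ w]) (auto intro: pres_cong.refl pres_cong.sym pres_cong_to_basis)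
  have \<psi>: "\<psi> (word_class {} w) = word_class pq_relators (of_basis w)" for w
    unfolding \<psi>_def word_class_eq_iff
    by (rule someI2[of _ w]) (auto intro: pres_cong.refl pres_cong.sym pres_cong_of_basis)
  have "\<phi> \<in> hom \<Gamma> free_group_rank2"
    by (auto simp: hom_def \<Gamma>_def carrier_presented_group word_class_mult \<phi> to_basis_append)
  moreover have "bij_betw \<phi> (carrier \<Gamma>) (carrier free_group_rank2)"
    by (rule bij_betw_byWitness[of _ \<psi>])
      (auto simp: \<Gamma>_def carrier_presented_group \<phi> \<psi> to_basis_of_basis of_basis_to_basis)
  ultimately show ?thesis by (auto simp: is_iso_def iso_def)
qed

section \<open>Normal forms\<close>

text \<open>
  The triple \<open>(k, e, v)\<close> encodes $p^k s^e$ followed by the reversal of \<open>v\<close>, a reduced word over the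
  basis $p, s$ that is empty or, read from its last entry, starts with a power of $p$.
\<close>

type_synonym nform = "int \<times> int \<times> gen word"

definition sgn_of :: "bool \<Rightarrow> int" where
  "sgn_of b = (if b then 1 else - 1)"

text \<open>Words are stored with their last letter at the head, so this is right multiplication by
  a letter with free cancellation.\<close>

fun push :: "'a \<times> bool \<Rightarrow> 'a word \<Rightarrow> 'a word" where
  "push l [] = [l]"
| "push l (l' # v) = (if fst l' = fst l \<and> snd l' \<noteq> snd l then v else l # l' # v)"

fun reduced :: "'a word \<Rightarrow> bool" where
  "reduced (l # l' # v) \<longleftrightarrow> \<not> (fst l' = fst l \<and> snd l' \<noteq> snd l) \<and> reduced (l' # v)"
| "reduced _ \<longleftrightarrow> True"

text \<open>These conditions make the triple unique: with e = 0 a leading power of p in the tail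
  would merge with p^k, and a leading power of s would merge with s^e.\<close>

fun valid :: "nform \<Rightarrow> bool" where
  "valid (k, e, v) \<longleftrightarrow> reduced v \<and> (v \<noteq> [] \<longrightarrow> e \<noteq> 0 \<and> fst (last v) = P)"

fun step_P :: "bool \<Rightarrow> nform \<Rightarrow> nform" where
  "step_P b (k, e, v) = (if e = 0 then (k + sgn_of b, e, v) else (k, e, push (P, b) v))"

fun step_S :: "bool \<Rightarrow> nform \<Rightarrow> nform" where
  "step_S b (k, e, v) = (if v = [] then (k, e + sgn_of b, v) else (k, e, push (S, b) v))"

text \<open>Van der Waerden's trick: letters act on normal forms by right multiplication. Once the
  action is seen to respect the relations, the normal form depends only on the group element, with
  no confluence argument.\<close>

fun step :: "gen \<times> bool \<Rightarrow> nform \<Rightarrow> nform" where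
  "step (P, b) x = step_P b x"
| "step (S, b) x = step_S b x"
| "step (Q, b) x = step_S True (step_S True (step_P (\<not> b) (step_S False (step_S False x))))"

lemma reduced_push: "reduced v \<Longrightarrow> reduced (push l v)"
  by (cases v rule: reduced.cases) auto

lemma push_push: "reduced v \<Longrightarrow> push (a, \<not> b) (push (a, b) v) = v"
  by (cases v rule: reduced.cases) auto

text \<open>The last entry could be cancelled only while it is also the head, and then its generator
  differs from that of \<open>l\<close>.\<close>

lemma push_last:
  assumes "v \<noteq> []" "fst (last v) \<noteq> fst l"
  shows "push l v \<noteq> [] \<and> last (push l v) = last v"
  using assms by (cases v) (auto split: if_splits)

lemma push_last_same:
  "v \<noteq> [] \<longrightarrow> fst (last v) = fst l \<Longrightarrow> push l v \<noteq> [] \<Longrightarrow> fst (last (push l v)) = fst l"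
  by (cases v) (auto split: if_splits)

lemma valid_step_P: "valid x \<Longrightarrow> valid (step_P b x)"
  by (cases x) (auto simp: reduced_push push_last_same[where l = "(P, b)", simplified])

lemma valid_step_S: "valid x \<Longrightarrow> valid (step_S b x)"
  by (cases x) (auto simp: reduced_push push_last)

lemma step_P_cancel: "valid x \<Longrightarrow> step_P (\<not> b) (step_P b x) = x"
  by (cases x) (auto simp: push_push sgn_of_def)

lemma step_S_cancel: "valid x \<Longrightarrow> step_S (\<not> b) (step_S b x) = x"
  by (cases x) (auto simp: push_push push_last sgn_of_def)

lemmas step_cancel_simps =
  step_P_cancel[of _ True, simplified] step_P_cancel[of _ False, simplified]
  step_S_cancel[of _ True, simplified] step_S_cancel[of _ False, simplified]

lemma valid_step: "valid x \<Longrightarrow> valid (step l x)"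
  by (cases "(l, x)" rule: step.cases) (auto simp: valid_step_P valid_step_S simp del: valid.simps)

lemma step_cancel: "valid x \<Longrightarrow> step (a, \<not> b) (step (a, b) x) = x"
  by (cases a; cases b)
    (simp_all add: step_cancel_simps valid_step_P valid_step_S del: valid.simps)

lemma valid_fold_step: "valid x \<Longrightarrow> valid (fold step w x)"
  by (induction w arbitrary: x) (auto simp: valid_step simp del: valid.simps)

text \<open>The relator acts trivially: with q expanded it consists of ten steps, which cancel in
  pairs from the middle outwards.\<close>

lemma fold_step_cong:
  "pres_cong pq_relators u v \<Longrightarrow> valid x \<Longrightarrow> fold step u x = fold step v x"
proof (induction arbitrary: x rule: pres_cong.induct)
  case (cancel u a b v)
  then show ?case by (simp add: step_cancel valid_fold_step del: valid.simps)
next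
  case (relator r u v)
  then show ?case
    by (simp add: pq_relators_def step_cancel_simps valid_step_P valid_step_S valid_fold_step
        del: valid.simps)
qed auto

definition nf :: "elt \<Rightarrow> nform" where
  "nf x = fold step (SOME w. x = word_class pq_relators w) (0, 0, [])"

lemma nf_word_class: "nf (word_class pq_relators w) = fold step w (0, 0, [])"
  unfolding nf_def word_class_eq_iff
  by (rule someI2[of _ w]) (auto intro: pres_cong.refl pres_cong.sym fold_step_cong)

lemma valid_nf: "x \<in> carrier \<Gamma> \<Longrightarrow> valid (nf x)"
  by (erule \<Gamma>_cases) (simp add: nf_word_class valid_fold_step)

lemma nf_mult_letter: "x \<in> carrier \<Gamma> \<Longrightarrow> nf (x \<otimes>\<^bsub>\<Gamma>\<^esub> letter l) = step l (nf x)"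
  by (erule \<Gamma>_cases) (simp add: nf_word_class flip: word_class_snoc)

lemma word_class_Nil [simp]: "word_class pq_relators [] = \<one>\<^bsub>\<Gamma>\<^esub>"
  by (simp add: \<Gamma>_def one_presented_group)

lemma nf_one: "nf \<one>\<^bsub>\<Gamma>\<^esub> = (0, 0, [])"
  using nf_word_class[of "[]"] by simp

section \<open>Recovering a group element from its normal form\<close>

fun nf_elt :: "nform \<Rightarrow> elt" where
  "nf_elt (k, e, v) = p [^]\<^bsub>\<Gamma>\<^esub> k \<otimes>\<^bsub>\<Gamma>\<^esub> s [^]\<^bsub>\<Gamma>\<^esub> e \<otimes>\<^bsub>\<Gamma>\<^esub> word_class pq_relators (rev v)"

lemma nf_elt_closed [simp]: "nf_elt x \<in> carrier \<Gamma>"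
  by (cases x) simp

lemma word_class_rev_push:
  "word_class pq_relators (rev (push l v)) = word_class pq_relators (rev v) \<otimes>\<^bsub>\<Gamma>\<^esub> letter l"
proof (cases "v \<noteq> [] \<and> fst (hd v) = fst l \<and> snd (hd v) \<noteq> snd l")
  case True
  then obtain a b v' where v: "v = (a, \<not> b) # v'" and l: "l = (a, b)"
    by (cases v; cases l) auto
  show ?thesis
    using letter_cancel[of a "\<not> b"] by (simp add: v l word_class_snoc \<Gamma>.m_assoc)
next
  case False
  then have "push l v = l # v" by (cases v) auto
  then show ?thesis by (simp add: word_class_snoc)
qed

lemma gen_pow_letter:
  "gen_elt a [^]\<^bsub>\<Gamma>\<^esub> (k + sgn_of b) = gen_elt a [^]\<^bsub>\<Gamma>\<^esub> (k :: int) \<otimes>\<^bsub>\<Gamma>\<^esub> letter (a, b)"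
  by (cases b) (simp_all add: sgn_of_def letter_True letter_False \<Gamma>.int_pow_mult \<Gamma>.int_pow_diff \<Gamma>.int_pow_1)

lemma nf_elt_step_P: "valid x \<Longrightarrow> nf_elt (step_P b x) = nf_elt x \<otimes>\<^bsub>\<Gamma>\<^esub> letter (P, b)"
  by (cases x) (auto simp: word_class_rev_push gen_pow_letter \<Gamma>.m_assoc)

lemma nf_elt_step_S: "valid x \<Longrightarrow> nf_elt (step_S b x) = nf_elt x \<otimes>\<^bsub>\<Gamma>\<^esub> letter (S, b)"
  by (cases x) (auto simp: word_class_rev_push gen_pow_letter \<Gamma>.m_assoc)

lemma nf_elt_step: "valid x \<Longrightarrow> nf_elt (step l x) = nf_elt x \<otimes>\<^bsub>\<Gamma>\<^esub> letter l"
  using letter_Q[of "snd l"]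
  by (cases "(l, x)" rule: step.cases)
    (simp_all add: nf_elt_step_P nf_elt_step_S valid_step_P valid_step_S \<Gamma>.m_assoc
      del: valid.simps nf_elt.simps)

text \<open>This recognises an element with normal form (k, c, []) as an actual vertex of the ladder
  in \<open>adj_cases\<close>.\<close>

lemma nf_elt_nf: "x \<in> carrier \<Gamma> \<Longrightarrow> nf_elt (nf x) = x"
proof (erule \<Gamma>_cases)
  fix w assume x: "x = word_class pq_relators w"
  show "nf_elt (nf x) = x"
    unfolding x
  proof (induction w rule: rev_induct)
    case (snoc l w)
    then show ?case
      by (simp add: word_class_snoc nf_mult_letter nf_elt_step valid_nf del: valid.simps nf_elt.simps)
  qed (simp add: nf_one)
qed

lemma nf_pow_P: "nf (p [^]\<^bsub>\<Gamma>\<^esub> (k :: int)) = (k, 0, [])"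
proof (induction k rule: int_induct[where k = 0])
  case base
  show ?case by (simp add: nf_one)
next
  case (step1 i)
  then show ?case
    using gen_pow_letter[of P i True] by (simp add: sgn_of_def nf_mult_letter)
next
  case (step2 i)
  then show ?case
    using gen_pow_letter[of P i False] by (simp add: sgn_of_def nf_mult_letter)
qed

lemma nf_mult_pow_S:
  assumes x: "x \<in> carrier \<Gamma>" and nf: "nf x = (k, e, [])"
  shows "nf (x \<otimes>\<^bsub>\<Gamma>\<^esub> s [^]\<^bsub>\<Gamma>\<^esub> (c :: int)) = (k, e + c, [])"
proof (induction c rule: int_induct[where k = 0])
  case base
  show ?case using assms by simp
next
  case (step1 i)
  then show ?case
    using gen_pow_letter[of S i True] x
    by (simp add: sgn_of_def nf_mult_letter flip: \<Gamma>.m_assoc)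
next
  case (step2 i)
  then show ?case
    using gen_pow_letter[of S i False] x
    by (simp add: sgn_of_def nf_mult_letter flip: \<Gamma>.m_assoc)
qed

section \<open>The retraction onto the ladder\<close>

fun column :: "nform \<Rightarrow> int" where
  "column (k, e, v) = max 0 (min 2 e)"

lemma step_S_nonempty:
  assumes "valid (k, e, v)" "v \<noteq> []"
  obtains v' where "step_S b (k, e, v) = (k, e, v')" "v' \<noteq> []" "valid (k, e, v')"
  using that[of "push (S, b) v"] valid_step_S[OF assms(1), of b] assms push_last[of v "(S, b)"]
  by simp

text \<open>The steps s^-2 only touch the tail, which starts with p. If the p-step then cancels what
  is left of the tail, the closing s^2 is absorbed into s^e. After clamping, passing from e to e + 2
  moves the column by two only for e = 0, which validity excludes.\<close>

lemma step_Q_nonempty: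
  assumes "valid (k, e, v)" "v \<noteq> []"
  shows "\<exists>e' v'. step (Q, b) (k, e, v) = (k, e', v') \<and> e \<noteq> 0 \<and> (e' = e \<or> e' = e + 2)"
proof -
  have e: "e \<noteq> 0" using assms by simp
  obtain v1 where 1: "step_S False (k, e, v) = (k, e, v1)" "v1 \<noteq> []" "valid (k, e, v1)"
    using assms by (rule step_S_nonempty)
  obtain v2 where 2: "step_S False (k, e, v1) = (k, e, v2)" "v2 \<noteq> []" "valid (k, e, v2)"
    using 1(3,2) by (rule step_S_nonempty)
  obtain w where w: "step_P (\<not> b) (k, e, v2) = (k, e, w)" "valid (k, e, w)"
    using valid_step_P[OF 2(3), of "\<not> b"] e by simp
  show ?thesis
  proof (cases "w = []")
    case True
    then show ?thesis using 1 2 w e by (simp add: sgn_of_def)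
  next
    case False
    obtain v3 where 3: "step_S True (k, e, w) = (k, e, v3)" "v3 \<noteq> []" "valid (k, e, v3)"
      using w(2) False by (rule step_S_nonempty)
    obtain v4 where 4: "step_S True (k, e, v3) = (k, e, v4)" "v4 \<noteq> []" "valid (k, e, v4)"
      using 3(3,2) by (rule step_S_nonempty)
    show ?thesis using 1 2 w(1) 3 4 e by (simp del: step_S.simps step_P.simps)
  qed
qed

text \<open>The exponent k moves only under p at e = 0 and under q at e = 2 with empty tail, that
  is, along the two sides.\<close>

lemma step_retract:
  assumes "valid x"
  shows "fst (step l x) = fst x \<and> \<bar>column (step l x) - column x\<bar> \<le> 1
    \<or> \<bar>fst (step l x) - fst x\<bar> \<le> 1 \<and> column (step l x) = column x \<and> snd x \<in> {(0, []), (2, [])}"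
proof -
  obtain a b k e v where l: "l = (a, b)" and x: "x = (k, e, v)"
    by (cases l; cases x)
  show ?thesis
  proof (cases a)
    case P
    then show ?thesis using assms by (auto simp: l x sgn_of_def)
  next
    case S
    then show ?thesis using assms by (auto simp: l x sgn_of_def)
  next
    case Q
    show ?thesis
    proof (cases "v = []")
      case True
      \<comment> \<open>Here q moves k if e = 2 and otherwise replaces e by e - 2; the column would
        drop by two only for e = 2.\<close>
      then show ?thesis using Q by (auto simp: l x sgn_of_def)
    next
      case False
      then obtain e' v' where "step l x = (k, e', v')" "e \<noteq> 0" "e' = e \<or> e' = e + 2"
        using step_Q_nonempty[of k e v b] assms Q unfolding l x by blast
      then show ?thesis by (auto simp: x)
    qed
  qed
qed

section \<open>The path metric\<close>

lemma adj_X_iff: "(u, v) \<in> adj X \<longleftrightarrow> u \<in> carrier \<Gamma> \<and> (\<exists>l. v = u \<otimes>\<^bsub>\<Gamma>\<^esub> letter l)"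
proof
  assume "(u, v) \<in> adj X"
  then consider a where "u \<in> carrier \<Gamma>" "v = u \<otimes>\<^bsub>\<Gamma>\<^esub> gen_elt a"
    | a where "v \<in> carrier \<Gamma>" "u = v \<otimes>\<^bsub>\<Gamma>\<^esub> gen_elt a"
    by (auto simp: parcs_mk_symmetric X_def cayley_graph_def)
  then show "u \<in> carrier \<Gamma> \<and> (\<exists>l. v = u \<otimes>\<^bsub>\<Gamma>\<^esub> letter l)"
  proof cases
    case 1
    then show ?thesis by (metis letter_True)
  next
    case 2
    then have "v = u \<otimes>\<^bsub>\<Gamma>\<^esub> letter (a, False)"
      by (simp add: letter_False \<Gamma>.m_assoc)
    then show ?thesis using 2 by auto
  qed
next
  assume "u \<in> carrier \<Gamma> \<and> (\<exists>l. v = u \<otimes>\<^bsub>\<Gamma>\<^esub> letter l)"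
  then obtain a b where u: "u \<in> carrier \<Gamma>" and v: "v = u \<otimes>\<^bsub>\<Gamma>\<^esub> letter (a, b)"
    by auto
  show "(u, v) \<in> adj X"
  proof (cases b)
    case True
    then show ?thesis
      using u v by (force simp: letter_True parcs_mk_symmetric X_def cayley_graph_def)
  next
    case False
    then have "u = v \<otimes>\<^bsub>\<Gamma>\<^esub> gen_elt a" "v \<in> carrier \<Gamma>"
      using u v by (simp_all add: letter_False \<Gamma>.m_assoc)
    then show ?thesis
      by (force simp: parcs_mk_symmetric X_def cayley_graph_def)
  qed
qed

lemma sym_adj: "sym (adj G)"
  by (auto simp: sym_def parcs_mk_symmetric)

lemma graph_dist_le: "(u, v) \<in> adj G ^^ n \<Longrightarrow> graph_dist G u v \<le> n"
  unfolding graph_dist_def by (rule Least_le)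

lemma graph_dist_self [simp]: "graph_dist G u u = 0"
  using graph_dist_le[of u u 0 G] by simp

lemma relpow_adj_sym: "(u, v) \<in> adj G ^^ n \<Longrightarrow> (v, u) \<in> adj G ^^ n"
proof (induction n arbitrary: u v)
  case (Suc n)
  then obtain w where "(u, w) \<in> adj G ^^ n" "(w, v) \<in> adj G"
    by auto
  then show ?case
    using Suc.IH sym_adj by (meson relpow_Suc_I2 symD)
qed simp

lemma graph_dist_sym: "graph_dist G u v = graph_dist G v u"
  unfolding graph_dist_def by (metis relpow_adj_sym)

text \<open>Ensures that the \<open>LEAST\<close> in \<open>graph_dist\<close> is attained by a
  path.\<close>

lemma X_connected:
  assumes "u \<in> carrier \<Gamma>" "v \<in> carrier \<Gamma>"
  shows "\<exists>n. (u, v) \<in> adj X ^^ n"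
proof -
  have "\<exists>n. (u, u \<otimes>\<^bsub>\<Gamma>\<^esub> word_class pq_relators w) \<in> adj X ^^ n" for w
  proof (induction w rule: rev_induct)
    case Nil
    show ?case using assms by (auto intro: exI[of _ 0])
  next
    case (snoc l w)
    then obtain n where "(u, u \<otimes>\<^bsub>\<Gamma>\<^esub> word_class pq_relators w) \<in> adj X ^^ n" by blast
    moreover have "(u \<otimes>\<^bsub>\<Gamma>\<^esub> word_class pq_relators w, u \<otimes>\<^bsub>\<Gamma>\<^esub> word_class pq_relators (w @ [l])) \<in> adj X"
      unfolding adj_X_iff using assms
      by (intro conjI exI[of _ l]) (simp_all add: word_class_snoc \<Gamma>.m_assoc)
    ultimately show ?case by (meson relpow_Suc_I)
  qed
  moreover obtain w where "inv\<^bsub>\<Gamma>\<^esub> u \<otimes>\<^bsub>\<Gamma>\<^esub> v = word_class pq_relators w"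
    using assms \<Gamma>_cases by (metis \<Gamma>.inv_closed \<Gamma>.m_closed)
  moreover have "u \<otimes>\<^bsub>\<Gamma>\<^esub> (inv\<^bsub>\<Gamma>\<^esub> u \<otimes>\<^bsub>\<Gamma>\<^esub> v) = v"
    using assms by (simp flip: \<Gamma>.m_assoc)
  ultimately show ?thesis by metis
qed

lemma graph_dist_path:
  assumes "u \<in> carrier \<Gamma>" "v \<in> carrier \<Gamma>"
  shows "(u, v) \<in> adj X ^^ graph_dist X u v"
  using LeastI_ex[OF X_connected[OF assms]] by (simp add: graph_dist_def)

lemma graph_dist_triangle:
  assumes "u \<in> carrier \<Gamma>" "v \<in> carrier \<Gamma>" "w \<in> carrier \<Gamma>"
  shows "graph_dist X u w \<le> graph_dist X u v + graph_dist X v w"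
  using assms by (intro graph_dist_le) (auto simp: relpow_add intro: graph_dist_path)

text \<open>Lower bounds on distances all come from such 1-Lipschitz functions; checking edges
  suffices, by induction along a shortest path.\<close>

definition nonexpansive :: "(elt \<Rightarrow> int) \<Rightarrow> bool" where
  "nonexpansive f \<longleftrightarrow> (\<forall>u v. (u, v) \<in> adj X \<longrightarrow> \<bar>f u - f v\<bar> \<le> 1)"

lemma nonexpansive_path:
  assumes "nonexpansive f"
  shows "(u, v) \<in> adj X ^^ n \<Longrightarrow> \<bar>f u - f v\<bar> \<le> int n"
proof (induction n arbitrary: v)
  case (Suc n)
  then obtain w where "(u, w) \<in> adj X ^^ n" "(w, v) \<in> adj X"
    by auto
  with Suc.IH[of w] assms show ?case
    by (fastforce simp: nonexpansive_def)
qed simp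

lemma nonexpansive_dist:
  assumes "nonexpansive f" "u \<in> carrier \<Gamma>" "v \<in> carrier \<Gamma>"
  shows "\<bar>f u - f v\<bar> \<le> int (graph_dist X u v)"
  using assms by (intro nonexpansive_path graph_dist_path)

text \<open>The function \<open>f\<close> certifies geodesicity: it bounds distances along the path
  from below, and the path itself bounds them from above.\<close>

lemma geodesic_rayI:
  assumes v: "\<rho> 0 \<in> carrier \<Gamma>" and adj: "\<And>n. (\<rho> n, \<rho> (Suc n)) \<in> adj X"
    and f: "nonexpansive f" "\<And>n. f (\<rho> n) = c + int n"
  shows "geodesic_ray X (\<rho> 0) \<rho>"
proof -
  have closed: "\<rho> n \<in> carrier \<Gamma>" for n
    using adj[of n] by (simp add: adj_X_iff)
  have path: "(\<rho> m, \<rho> (m + n)) \<in> adj X ^^ n" for m n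
    by (induction n) (auto intro: relpow_Suc_I adj)
  have dist: "graph_dist X (\<rho> m) (\<rho> (m + n)) = n" for m n
    using graph_dist_le[OF path] nonexpansive_dist[OF f(1) closed closed, of m "m + n"]
    by (simp add: f(2) order_antisym)
  have "int (graph_dist X (\<rho> m) (\<rho> n)) = \<bar>int m - int n\<bar>" for m n
    using dist[of m "n - m"] dist[of n "m - n"] graph_dist_sym[of X "\<rho> m"]
    by (cases "m \<le> n") auto
  then show ?thesis
    using v adj by (simp add: geodesic_ray_def X_def cayley_graph_def)
qed

section \<open>Boundary points\<close>

lemma geodesic_rays_closed: "\<rho> \<in> geodesic_rays X \<Longrightarrow> \<rho> n \<in> carrier \<Gamma>"
  by (auto simp: geodesic_rays_def geodesic_ray_def adj_X_iff)

text \<open>Lets any member of a boundary point serve as its representative, in particular the ray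
  along a side.\<close>

lemma equiv_ray_equiv: "equiv (geodesic_rays X) (ray_equiv X)"
proof (rule equivI)
  show "ray_equiv X \<subseteq> geodesic_rays X \<times> geodesic_rays X"
    by (auto simp: ray_equiv_def)
  show "refl_on (geodesic_rays X) (ray_equiv X)"
  proof (rule refl_onI)
    fix \<rho> assume "\<rho> \<in> geodesic_rays X"
    moreover have "\<exists>n. graph_dist X (\<rho> m) (\<rho> n) \<le> 0" for m
      by (rule exI[of _ m]) simp
    ultimately show "(\<rho>, \<rho>) \<in> ray_equiv X"
      unfolding ray_equiv_def by blast
  qed
  show "sym (ray_equiv X)"
    by (auto simp: sym_def ray_equiv_def)
  have half: "\<exists>n. graph_dist X (\<rho> m) (\<tau> n) \<le> R + R'"
    if near: "\<forall>m. \<exists>n. graph_dist X (\<rho> m) (\<sigma> n) \<le> R" "\<forall>m. \<exists>n. graph_dist X (\<sigma> m) (\<tau> n) \<le> R'"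
      and rays: "\<rho> \<in> geodesic_rays X" "\<sigma> \<in> geodesic_rays X" "\<tau> \<in> geodesic_rays X" for \<rho> \<sigma> \<tau> R R' m
  proof -
    obtain n where n: "graph_dist X (\<rho> m) (\<sigma> n) \<le> R" using near by blast
    obtain k where k: "graph_dist X (\<sigma> n) (\<tau> k) \<le> R'" using near by blast
    have "graph_dist X (\<rho> m) (\<tau> k) \<le> graph_dist X (\<rho> m) (\<sigma> n) + graph_dist X (\<sigma> n) (\<tau> k)"
      using rays by (intro graph_dist_triangle geodesic_rays_closed)
    with n k show ?thesis by (intro exI[of _ k]) simp
  qed
  show "trans (ray_equiv X)"
  proof (rule transI)
    fix \<rho> \<sigma> \<tau>
    assume "(\<rho>, \<sigma>) \<in> ray_equiv X" "(\<sigma>, \<tau>) \<in> ray_equiv X"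
    then obtain R R' where R: "\<rho> \<in> geodesic_rays X" "\<sigma> \<in> geodesic_rays X" "\<tau> \<in> geodesic_rays X"
      "\<forall>m. \<exists>n. graph_dist X (\<rho> m) (\<sigma> n) \<le> R" "\<forall>m. \<exists>n. graph_dist X (\<sigma> m) (\<rho> n) \<le> R"
      "\<forall>m. \<exists>n. graph_dist X (\<sigma> m) (\<tau> n) \<le> R'" "\<forall>m. \<exists>n. graph_dist X (\<tau> m) (\<sigma> n) \<le> R'"
      unfolding ray_equiv_def by blast
    have "\<exists>n. graph_dist X (\<rho> m) (\<tau> n) \<le> R + R'" for m
      using half[OF R(4,6,1,2,3)] .
    moreover have "\<exists>n. graph_dist X (\<tau> m) (\<rho> n) \<le> R + R'" for m
      using half[OF R(7,5,3,2,1)] by (simp add: add.commute)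
    ultimately show "(\<rho>, \<tau>) \<in> ray_equiv X"
      using R(1,3) unfolding ray_equiv_def by blast
  qed
qed

lemma in_boundary_point_iff:
  assumes "\<gamma> \<in> gromov_boundary X" "\<tau> \<in> \<gamma>"
  shows "\<rho> \<in> \<gamma> \<longleftrightarrow> (\<tau>, \<rho>) \<in> ray_equiv X"
proof -
  obtain \<sigma> where "\<gamma> = ray_equiv X `` {\<sigma>}"
    using assms(1) unfolding gromov_boundary_def by (rule quotientE)
  moreover from this have "(\<sigma>, \<tau>) \<in> ray_equiv X" using assms(2) by simp
  ultimately have "\<gamma> = ray_equiv X `` {\<tau>}"
    using equiv_class_eq[OF equiv_ray_equiv] by metis
  then show ?thesis by simp
qed

section \<open>Ladders\<close>

text \<open>Common coordinates for the ladder: columns 0, 1 and 2 are the p-side, the rung middles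
  and the q-side.\<close>

definition lvert :: "elt \<Rightarrow> int \<Rightarrow> int \<Rightarrow> elt" where
  "lvert g k c = g \<otimes>\<^bsub>\<Gamma>\<^esub> p [^]\<^bsub>\<Gamma>\<^esub> k \<otimes>\<^bsub>\<Gamma>\<^esub> s [^]\<^bsub>\<Gamma>\<^esub> c"

text \<open>Rung index under the retraction, defined on the whole group; translating by the inverse
  of \<open>g\<close> moves the ladder to the identity.\<close>

definition lpos :: "elt \<Rightarrow> elt \<Rightarrow> int" where
  "lpos g x = fst (nf (inv\<^bsub>\<Gamma>\<^esub> g \<otimes>\<^bsub>\<Gamma>\<^esub> x))"

definition lcol :: "elt \<Rightarrow> elt \<Rightarrow> int" where
  "lcol g x = column (nf (inv\<^bsub>\<Gamma>\<^esub> g \<otimes>\<^bsub>\<Gamma>\<^esub> x))"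

context
  fixes g :: elt
  assumes g [simp]: "g \<in> carrier \<Gamma>"
begin

lemma lvert_closed [simp]: "lvert g k c \<in> carrier \<Gamma>"
  by (simp add: lvert_def)

lemma p_vertex_eq: "p_vertex g k = lvert g k 0"
  by (simp add: lvert_def)

lemma mid_vertex_eq: "mid_vertex g k = lvert g k 1"
  by (simp add: lvert_def \<Gamma>.int_pow_1)

lemma lvert_S: "lvert g k c \<otimes>\<^bsub>\<Gamma>\<^esub> s = lvert g k (c + 1)"
  using gen_pow_letter[of S c True] by (simp add: lvert_def letter_True sgn_of_def \<Gamma>.m_assoc)

lemma q_vertex_eq: "q_vertex g k = lvert g k 2"
  by (simp add: mid_vertex_eq lvert_S)

lemma lvert_P: "lvert g k 0 \<otimes>\<^bsub>\<Gamma>\<^esub> p = lvert g (k + 1) 0"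
  using gen_pow_letter[of P k True] by (simp add: lvert_def letter_True sgn_of_def \<Gamma>.m_assoc)

lemma lvert_Q: "lvert g k 2 \<otimes>\<^bsub>\<Gamma>\<^esub> q = lvert g (k - 1) 2"
  using q_vertex_q[OF g, of k] by (simp add: q_vertex_eq)

lemma nf_lvert: "nf (inv\<^bsub>\<Gamma>\<^esub> g \<otimes>\<^bsub>\<Gamma>\<^esub> lvert g k c) = (k, c, [])"
proof -
  have "inv\<^bsub>\<Gamma>\<^esub> g \<otimes>\<^bsub>\<Gamma>\<^esub> lvert g k c = p [^]\<^bsub>\<Gamma>\<^esub> k \<otimes>\<^bsub>\<Gamma>\<^esub> s [^]\<^bsub>\<Gamma>\<^esub> c"
    by (simp add: lvert_def flip: \<Gamma>.m_assoc)
  then show ?thesis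
    using nf_mult_pow_S[OF _ nf_pow_P, of k c] by simp
qed

lemma lpos_lvert [simp]: "lpos g (lvert g k c) = k"
  by (simp add: lpos_def nf_lvert)

lemma lcol_lvert [simp]: "lcol g (lvert g k c) = max 0 (min 2 c)"
  by (simp add: lcol_def nf_lvert)

text \<open>In the second case \<open>u\<close> itself, not only its retraction, lies on a side;
  \<open>ray_meets_side\<close> depends on this.\<close>

lemma adj_cases:
  assumes "(u, v) \<in> adj X"
  obtains (column) "lpos g v = lpos g u" "\<bar>lcol g v - lcol g u\<bar> \<le> 1"
  | (side) c where "c \<in> {0, 2}" "u = lvert g (lpos g u) c" "\<bar>lpos g v - lpos g u\<bar> \<le> 1"
      "lcol g u = c" "lcol g v = c"
proof -
  obtain l where u: "u \<in> carrier \<Gamma>" and v: "v = u \<otimes>\<^bsub>\<Gamma>\<^esub> letter l"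
    using assms by (auto simp: adj_X_iff)
  let ?x = "inv\<^bsub>\<Gamma>\<^esub> g \<otimes>\<^bsub>\<Gamma>\<^esub> u"
  have x: "?x \<in> carrier \<Gamma>" using u by simp
  have nf_v: "nf (inv\<^bsub>\<Gamma>\<^esub> g \<otimes>\<^bsub>\<Gamma>\<^esub> v) = step l (nf ?x)"
    using u nf_mult_letter[OF x] by (simp add: v \<Gamma>.m_assoc)
  consider "fst (step l (nf ?x)) = fst (nf ?x)" "\<bar>column (step l (nf ?x)) - column (nf ?x)\<bar> \<le> 1"
    | "\<bar>fst (step l (nf ?x)) - fst (nf ?x)\<bar> \<le> 1" "column (step l (nf ?x)) = column (nf ?x)"
      "snd (nf ?x) \<in> {(0, []), (2, [])}"
    using step_retract[OF valid_nf[OF x], of l] by blast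
  then show thesis
  proof cases
    case 1
    then show thesis by (intro column) (simp_all add: lpos_def lcol_def nf_v)
  next
    case 2
    then obtain k c where c: "c \<in> {0, 2}" "nf ?x = (k, c, [])"
      by (cases "nf ?x") auto
    then have "?x = p [^]\<^bsub>\<Gamma>\<^esub> k \<otimes>\<^bsub>\<Gamma>\<^esub> s [^]\<^bsub>\<Gamma>\<^esub> c"
      using nf_elt_nf[OF x] by simp
    then have "g \<otimes>\<^bsub>\<Gamma>\<^esub> ?x = lvert g k c"
      by (simp add: lvert_def \<Gamma>.m_assoc)
    then have "u = lvert g k c"
      using u by (simp flip: \<Gamma>.m_assoc)
    then show thesis
      using 2 c by (intro side[of c]) (auto simp: lpos_def lcol_def nf_v)
  qed
qed

text \<open>An edge changes at most one of the two coordinates, and that one by at most 1, so signed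
  sums are 1-Lipschitz.\<close>

lemma nonexpansive_diagonal:
  assumes "\<epsilon> \<in> {1, - 1}" "\<delta> \<in> {1, - 1}"
  shows "nonexpansive (\<lambda>x. \<epsilon> * lpos g x + \<delta> * lcol g x)"
  unfolding nonexpansive_def
proof (intro allI impI)
  fix u v assume "(u, v) \<in> adj X"
  then show "\<bar>(\<epsilon> * lpos g u + \<delta> * lcol g u) - (\<epsilon> * lpos g v + \<delta> * lcol g v)\<bar> \<le> 1"
    using assms by (cases rule: adj_cases) auto
qed

lemma nonexpansive_lpos: "nonexpansive (lpos g)"
  unfolding nonexpansive_def by (auto elim!: adj_cases)

text \<open>The distance inside the ladder from the middle of rung \<open>j\<close> to the
  retraction of \<open>x\<close>: half a rung out to a side, then along it, then half a rung in if
  the target is another middle.\<close>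

definition mid_dist :: "int \<Rightarrow> elt \<Rightarrow> int" where
  "mid_dist j x = (if lcol g x = 1 then if lpos g x = j then 0 else \<bar>lpos g x - j\<bar> + 2
     else \<bar>lpos g x - j\<bar> + 1)"

lemma lcol_range: "lcol g x \<in> {0, 1, 2}"
  by (cases "nf (inv\<^bsub>\<Gamma>\<^esub> g \<otimes>\<^bsub>\<Gamma>\<^esub> x)") (auto simp: lcol_def)

lemma nonexpansive_mid_dist: "nonexpansive (mid_dist j)"
  unfolding nonexpansive_def
proof (intro allI impI)
  fix u v assume "(u, v) \<in> adj X"
  then show "\<bar>mid_dist j u - mid_dist j v\<bar> \<le> 1"
    using lcol_range[of u] lcol_range[of v] by (cases rule: adj_cases) (auto simp: mid_dist_def)
qed

lemma mid_dist_le: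
  "x \<in> carrier \<Gamma> \<Longrightarrow> mid_dist j x \<le> int (graph_dist X (lvert g j 1) x)"
  using nonexpansive_dist[OF nonexpansive_mid_dist, of "lvert g j 1" x j]
  by (simp add: mid_dist_def split: if_splits)

section \<open>Paths in the ladder and upper bounds on distances\<close>

lemma adj_gen: "u \<in> carrier \<Gamma> \<Longrightarrow> (u, u \<otimes>\<^bsub>\<Gamma>\<^esub> gen_elt a) \<in> adj X"
  by (auto simp: adj_X_iff simp flip: letter_True)

lemma adj_column: "(lvert g k c, lvert g k (c + 1)) \<in> adj X"
  using adj_gen[of "lvert g k c" S] by (simp add: lvert_S)

lemma adj_side:
  assumes "c \<in> {0, 2}"
  shows "(lvert g k c, lvert g (k + 1) c) \<in> adj X"
  using assms adj_gen[of "lvert g k 0" P] symD[OF sym_adj adj_gen[of "lvert g (k + 1) 2" Q]]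
  by (auto simp: lvert_P lvert_Q)

lemma adj_mid:
  assumes "c \<in> {0, 2}"
  shows "(lvert g k 1, lvert g k c) \<in> adj X"
  using assms adj_column[of k 1] symD[OF sym_adj adj_column[of k 0]] by auto

lemma side_dist:
  assumes "c \<in> {0, 2}"
  shows "graph_dist X (lvert g k c) (lvert g l c) \<le> nat \<bar>k - l\<bar>"
proof -
  have path: "(lvert g i c, lvert g (i + int n) c) \<in> adj X ^^ n" for i n
  proof (induction n)
    case (Suc n)
    then show ?case
      using adj_side[OF assms, of "i + int n"] by (auto simp: algebra_simps)
  qed simp
  show ?thesis
    using graph_dist_le[OF path, of k "nat (l - k)"] graph_dist_le[OF path, of l "nat (k - l)"]
      graph_dist_sym[of X "lvert g k c"]
    by (cases "k \<le> l") auto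
qed

lemma column_dist:
  assumes "c \<in> {0, 1, 2}"
  shows "graph_dist X (lvert g k 0) (lvert g k c) \<le> 2"
proof -
  have "(lvert g k 0, lvert g k 1) \<in> adj X ^^ 1" "(lvert g k 0, lvert g k 2) \<in> adj X ^^ 2"
    using adj_column[of k 0] adj_column[of k 1] by (auto simp: numeral_2_eq_2)
  then show ?thesis
    using assms graph_dist_le by fastforce
qed

lemma ladder_dist:
  assumes "c \<in> {0, 1, 2}"
  shows "graph_dist X (lvert g k 0) (lvert g l c) \<le> nat \<bar>k - l\<bar> + 2"
  using graph_dist_triangle[of "lvert g k 0" "lvert g l 0" "lvert g l c"]
    side_dist[of 0 k l] column_dist[OF assms, of l] by simp

lemma mid_side_dist:
  assumes "c \<in> {0, 2}"
  shows "graph_dist X (lvert g k 1) (lvert g l c) \<le> nat \<bar>k - l\<bar> + 1"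
proof -
  have "(lvert g k 1, lvert g k c) \<in> adj X ^^ 1"
    using adj_mid[OF assms] by simp
  then show ?thesis
    using graph_dist_triangle[of "lvert g k 1" "lvert g k c" "lvert g l c"]
      side_dist[OF assms, of k l] graph_dist_le by fastforce
qed

section \<open>Ray bundles towards the end in direction \<open>\<epsilon>\<close>\<close>

context
  fixes \<gamma> :: "(nat \<Rightarrow> elt) set" and \<epsilon> :: int
  assumes \<epsilon>: "\<epsilon> \<in> {1, - 1}" and boundary: "\<gamma> \<in> gromov_boundary X"
    and end_ray: "(\<lambda>n. lvert g (\<epsilon> * int n) 0) \<in> \<gamma>"
begin

text \<open>
  Follow the side through \<open>x\<close> up to rung \<open>i + \<epsilon> * N\<close>, cross this rung, and continue on the other side.
  This path is geodesic because crossing moves away from \<open>x\<close> in the same way as the sides do.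
\<close>

lemma mid_in_side_bundle:
  assumes c: "c \<in> {0, 2}"
  shows "lvert g (i + \<epsilon> * int N) 1 \<in> ray_bundle X (lvert g i c) \<gamma>"
proof -
  \<comment> \<open>Times N, N + 1 and N + 2 are spent on the crossed rung, whence the delay of two
    afterwards; the maximum covers time N + 1.\<close>
  define pos where "pos n = i + \<epsilon> * int (if n \<le> N then n else max N (n - 2))" for n
  define col where "col n = (if n \<le> N then c else if n = Suc N then 1 else 2 - c)" for n
  define \<rho> where "\<rho> n = lvert g (pos n) (col n)" for n
  have adj: "(\<rho> n, \<rho> (Suc n)) \<in> adj X" for n
  proof -
    have side: "(lvert g l d, lvert g (l + \<epsilon>) d) \<in> adj X" if "d \<in> {0, 2}" for l d
      using \<epsilon> adj_side[OF that, of l] symD[OF sym_adj adj_side[OF that, of "l - 1"]] by auto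
    have c': "2 - c \<in> {0, 2}" using c by auto
    consider "n < N" | "n = N" | "n = Suc N" | "n > Suc N" by linarith
    then show ?thesis
    proof cases
      case 1
      then show ?thesis
        using side[OF c, of "pos n"] by (simp add: \<rho>_def pos_def col_def algebra_simps)
    next
      case 2
      then show ?thesis
        using symD[OF sym_adj adj_mid[OF c, of "pos n"]] by (simp add: \<rho>_def pos_def col_def)
    next
      case 3
      then show ?thesis
        using adj_mid[OF c', of "pos n"] by (simp add: \<rho>_def pos_def col_def)
    next
      case 4
      then have "pos (Suc n) = pos n + \<epsilon>" "col n = 2 - c" "col (Suc n) = 2 - c"
        by (auto simp: pos_def col_def max_def of_nat_diff algebra_simps)
      then show ?thesis
        using side[OF c', of "pos n"] by (simp add: \<rho>_def)
    qed
  qed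
  \<comment> \<open>The sign is chosen so that crossing from column c to 2 - c increases the
    function, just as moving towards the end does.\<close>
  define \<delta> :: int where "\<delta> = (if c = 0 then 1 else - 1)"
  have f: "\<epsilon> * lpos g (\<rho> n) + \<delta> * lcol g (\<rho> n) = (\<epsilon> * i + \<delta> * c) + int n" for n
    using c \<epsilon> by (auto simp: \<rho>_def pos_def col_def \<delta>_def max_def algebra_simps)
  have "\<delta> \<in> {1, - 1}" "\<rho> 0 \<in> carrier \<Gamma>"
    by (auto simp: \<delta>_def \<rho>_def)
  then have "geodesic_ray X (\<rho> 0) \<rho>"
    using geodesic_rayI[of \<rho>, OF _ adj nonexpansive_diagonal f] \<epsilon> by blast
  moreover have "\<rho> 0 = lvert g i c"
    by (simp add: \<rho>_def pos_def col_def)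
  ultimately have ray: "geodesic_ray X (lvert g i c) \<rho>"
    by simp
  \<comment> \<open>At equal times the rung indices differ by at most |i| + N + 2, and
    \<open>ladder_dist\<close> adds 2 for the columns.\<close>
  define R where "R = nat \<bar>i\<bar> + N + 4"
  have near: "graph_dist X (lvert g (\<epsilon> * int n) 0) (\<rho> n) \<le> R" for n
  proof -
    have "col n \<in> {0, 1, 2}" using c by (auto simp: col_def)
    moreover have "\<bar>\<epsilon> * int n - pos n\<bar> \<le> \<bar>i\<bar> + int N + 2"
      using \<epsilon> by (auto simp: pos_def max_def)
    ultimately show ?thesis
      using ladder_dist[of "col n" "\<epsilon> * int n" "pos n"] by (simp add: \<rho>_def R_def)
  qed
  then have near': "graph_dist X (\<rho> n) (lvert g (\<epsilon> * int n) 0) \<le> R" for n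
    by (simp add: graph_dist_sym[of X "\<rho> n"])
  have "(\<lambda>n. lvert g (\<epsilon> * int n) 0) \<in> geodesic_rays X"
    using end_ray boundary in_boundary_point_iff by (auto simp: ray_equiv_def)
  moreover have "\<rho> \<in> geodesic_rays X"
    using ray by (auto simp: geodesic_rays_def)
  ultimately have "(\<lambda>n. lvert g (\<epsilon> * int n) 0, \<rho>) \<in> ray_equiv X"
    unfolding ray_equiv_def using near near' by blast
  then have "\<rho> \<in> \<gamma>"
    using in_boundary_point_iff[OF boundary end_ray] by simp
  moreover have "\<rho> (Suc N) = lvert g (i + \<epsilon> * int N) 1"
    by (simp add: \<rho>_def pos_def col_def)
  ultimately show ?thesis
    using ray unfolding ray_bundle_def by (metis (mono_tags, lifting) mem_Collect_eq)
qed

text \<open>Away from the sides \<open>lpos\<close> cannot change. A ray avoiding them from time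
  \<open>t\<close> on would have bounded \<open>lpos\<close>, while the side ray to the same end,
  which must stay near it, has unbounded \<open>lpos\<close>.\<close>

lemma ray_meets_side:
  assumes ray: "geodesic_ray X v \<rho>" "\<rho> \<in> \<gamma>"
  obtains t' l c where "t' \<ge> t" "c \<in> {0, 2}" "\<rho> t' = lvert g l c"
proof (rule ccontr)
  note meet = that
  assume "\<not> thesis"
  then have off: "\<rho> t' \<noteq> lvert g l c" if t': "t' \<ge> t" "c \<in> {0, 2}" for t' l c
    using meet t' by blast
  have adj: "(\<rho> n, \<rho> (Suc n)) \<in> adj X" for n
    using ray by (simp add: geodesic_ray_def)
  have closed: "\<rho> n \<in> carrier \<Gamma>" for n
    using adj by (simp add: adj_X_iff)
  have const: "lpos g (\<rho> (t + n)) = lpos g (\<rho> t)" for n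
  proof (induction n)
    case (Suc n)
    show ?case
      using adj[of "t + n"]
    proof (cases rule: adj_cases)
      case column
      then show ?thesis using Suc by simp
    next
      case (side c)
      then show ?thesis using off[of "t + n" c] by auto
    qed
  qed simp
  \<comment> \<open>Up to time \<open>t\<close> the position drifts by at most \<open>t\<close>;
    afterwards it is frozen.\<close>
  define B where "B = \<bar>lpos g (\<rho> 0)\<bar> + int t"
  have bound: "\<bar>lpos g (\<rho> n)\<bar> \<le> B" for n
  proof -
    have step: "\<bar>lpos g (\<rho> m)\<bar> \<le> \<bar>lpos g (\<rho> 0)\<bar> + int m" for m
    proof -
      have "graph_dist X (\<rho> 0) (\<rho> m) = m"
        using ray by (simp add: geodesic_ray_def) (metis abs_minus_commute abs_of_nat diff_0_right of_nat_0 of_nat_eq_iff)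
      then show ?thesis
        using nonexpansive_dist[OF nonexpansive_lpos closed closed, of 0 m] by simp
    qed
    show ?thesis
    proof (cases "n \<le> t")
      case True
      then show ?thesis using step[of n] by (simp add: B_def)
    next
      case False
      then show ?thesis using step[of t] const[of "n - t"] by (simp add: B_def)
    qed
  qed
  obtain R where R: "\<forall>m. \<exists>n. graph_dist X (lvert g (\<epsilon> * int m) 0) (\<rho> n) \<le> R"
    using ray(2) in_boundary_point_iff[OF boundary end_ray] by (auto simp: ray_equiv_def)
  \<comment> \<open>At this time the side ray is on a rung whose index has absolute value above R +
    B, out of reach of every vertex of the ray.\<close>
  define m where "m = R + nat B + 1"
  obtain n where n: "graph_dist X (lvert g (\<epsilon> * int m) 0) (\<rho> n) \<le> R"
    using R by blast
  have "\<bar>\<epsilon> * int m - lpos g (\<rho> n)\<bar> \<le> int R"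
    using nonexpansive_dist[OF nonexpansive_lpos _ closed, of "lvert g (\<epsilon> * int m) 0" n] n by simp
  moreover have "\<bar>\<epsilon> * int m\<bar> = int m"
    using \<epsilon> by auto
  moreover have "int R + B < int m"
    by (simp add: m_def)
  ultimately show False
    using bound[of n] by linarith
qed

text \<open>The detour through a second middle vertex shows once the ray is continued to its next
  vertex on a side, which could have been reached directly from the first middle.\<close>

lemma mid_not_in_mid_bundle:
  assumes "k \<noteq> j"
  shows "lvert g k 1 \<notin> ray_bundle X (lvert g j 1) \<gamma>"
proof
  assume "lvert g k 1 \<in> ray_bundle X (lvert g j 1) \<gamma>"
  then obtain \<rho> t where ray: "geodesic_ray X (lvert g j 1) \<rho>" "\<rho> \<in> \<gamma>" and t: "\<rho> t = lvert g k 1"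
    unfolding ray_bundle_def by auto
  obtain t' l c where t': "t' \<ge> t" "c \<in> {0, 2}" "\<rho> t' = lvert g l c"
    using ray by (rule ray_meets_side)
  have dist: "int (graph_dist X (\<rho> m) (\<rho> n)) = \<bar>int m - int n\<bar>" for m n
    using ray(1) by (simp add: geodesic_ray_def)
  have 0: "\<rho> 0 = lvert g j 1"
    using ray(1) by (simp add: geodesic_ray_def)
  have "\<bar>k - j\<bar> + 2 \<le> int t"
    using mid_dist_le[of "lvert g k 1" j] dist[of 0 t] assms by (simp add: 0 t mid_dist_def)
  moreover have "\<bar>l - k\<bar> + 1 \<le> int t' - int t"
    using mid_dist_le[of "lvert g l c" k] dist[of t t'] t' by (auto simp: t mid_dist_def)
  moreover have "int t' \<le> \<bar>j - l\<bar> + 1"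
    using mid_side_dist[OF t'(2), of j l] dist[of 0 t'] by (simp add: 0 t'(3))
  \<comment> \<open>The bounds combine to |k - j| + |l - k| + 3 \<le> |j - l| + 1, against the
    triangle inequality.\<close>
  ultimately show False by linarith
qed

lemma infinite_sym_diff:
  assumes "c \<in> {0, 2}"
  shows "infinite (sym_diff (ray_bundle X (lvert g i c) \<gamma>) (ray_bundle X (lvert g j 1) \<gamma>))"
proof -
  have inj: "inj (\<lambda>N. lvert g (i + \<epsilon> * int N) 1)"
  proof (rule injI)
    fix N N' assume "lvert g (i + \<epsilon> * int N) 1 = lvert g (i + \<epsilon> * int N') 1"
    then have "i + \<epsilon> * int N = i + \<epsilon> * int N'" by (metis lpos_lvert)
    then show "N = N'" using \<epsilon> by auto
  qed
  \<comment> \<open>For N beyond this bound the crossed rung is not rung \<open>j\<close>, as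
    \<open>mid_not_in_mid_bundle\<close> requires.\<close>
  let ?A = "{nat \<bar>j - i\<bar> <..}"
  have "(\<lambda>N. lvert g (i + \<epsilon> * int N) 1) ` ?A
      \<subseteq> sym_diff (ray_bundle X (lvert g i c) \<gamma>) (ray_bundle X (lvert g j 1) \<gamma>)"
  proof (intro subsetI, elim imageE)
    fix x N assume x: "x = lvert g (i + \<epsilon> * int N) 1" and N: "N \<in> ?A"
    then have "i + \<epsilon> * int N \<noteq> j" using \<epsilon> by auto
    then show "x \<in> sym_diff (ray_bundle X (lvert g i c) \<gamma>) (ray_bundle X (lvert g j 1) \<gamma>)"
      using mid_not_in_mid_bundle mid_in_side_bundle[OF assms] x by simp
  qed
  moreover have "infinite ((\<lambda>N. lvert g (i + \<epsilon> * int N) 1) ` ?A)"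
    using inj by (simp add: finite_image_iff inj_on_subset infinite_Ioi)
  ultimately show ?thesis
    using finite_subset by blast
qed

end

end

section \<open>Independence of the base point\<close>

text \<open>The arcs labelled p in a ladder are exactly those of its p-side, so the subgraph
  determines their tails, the vertices g p^n.\<close>

lemma ladder_base_unique:
  assumes "h \<in> carrier \<Gamma>" and eq: "ladder g = ladder h"
  obtains n :: int where "h = g \<otimes>\<^bsub>\<Gamma>\<^esub> p [^]\<^bsub>\<Gamma>\<^esub> n"
proof -
  have P_arcs: "(x, P) \<in> arcs (ladder g') \<longleftrightarrow> x \<in> range (p_vertex g')" for x g'
    by (auto simp: ladder_def union_def pre_digraph.Union_def p_side_def q_side_def rung_def
        part_of_X_def)
  have "(p_vertex h 0, P) \<in> arcs (ladder g)"
    unfolding eq P_arcs by blast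
  then have "p_vertex h 0 \<in> range (p_vertex g)"
    unfolding P_arcs .
  then obtain n where "p_vertex h 0 = p_vertex g n"
    by (rule rangeE)
  then show thesis
    using that assms(1) by simp
qed

lemma lvert_shift:
  assumes "g \<in> carrier \<Gamma>"
  shows "lvert (g \<otimes>\<^bsub>\<Gamma>\<^esub> p [^]\<^bsub>\<Gamma>\<^esub> (n :: int)) k c = lvert g (n + k) c"
  using assms by (simp add: lvert_def \<Gamma>.m_assoc \<Gamma>.int_pow_mult)

theorem corollary4p3:
  shows "\<Gamma> \<cong> free_group_rank2 \<and>
    (\<forall>L M \<gamma> x y. is_pq_ladder L \<longrightarrow> is_end_of \<gamma> L \<longrightarrow> is_side_of M L \<longrightarrow> x \<in> verts M \<longrightarrow>
      is_rung_middle_of y L \<longrightarrow>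
      infinite (sym_diff (ray_bundle X x \<gamma>) (ray_bundle X y \<gamma>)))"
proof (intro conjI allI impI \<Gamma>_iso_free_group)
  fix L M \<gamma> x y
  assume L: "is_end_of \<gamma> L" "is_side_of M L" "x \<in> verts M" "is_rung_middle_of y L"
  obtain g where g: "g \<in> carrier \<Gamma>" "L = ladder g" and boundary: "\<gamma> \<in> gromov_boundary X"
    and "(\<lambda>n. p_vertex g (int n)) \<in> \<gamma> \<or> (\<lambda>n. p_vertex g (- int n)) \<in> \<gamma>"
    using L(1) unfolding is_end_of_def by blast
  then have "(\<lambda>n. lvert g (1 * int n) 0) \<in> \<gamma> \<or> (\<lambda>n. lvert g (- 1 * int n) 0) \<in> \<gamma>"
    by (simp add: p_vertex_eq)
  then obtain \<epsilon> :: int where \<epsilon>: "\<epsilon> \<in> {1, - 1}" "(\<lambda>n. lvert g (\<epsilon> * int n) 0) \<in> \<gamma>"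
    by blast
  obtain h where h: "h \<in> carrier \<Gamma>" "L = ladder h" "M = p_side h \<or> M = q_side h"
    using L(2) unfolding is_side_of_def by blast
  then have "x \<in> range (p_vertex h) \<union> range (q_vertex h)"
    using L(3) by (auto simp: p_side_def q_side_def part_of_X_def)
  then obtain k where "x = p_vertex h k \<or> x = q_vertex h k"
    by blast
  then have "x = lvert h k 0 \<or> x = lvert h k 2"
    unfolding q_vertex_eq[OF h(1)] unfolding p_vertex_eq[OF h(1)] .
  then obtain c where c: "c \<in> {0, 2}" "x = lvert h k c"
    by blast
  \<comment> \<open>End, side and rung middle may each come with their own base point; all
    coordinates are moved to \<open>g\<close>.\<close>
  obtain n :: int where "h = g \<otimes>\<^bsub>\<Gamma>\<^esub> p [^]\<^bsub>\<Gamma>\<^esub> n"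
    using ladder_base_unique g h by metis
  then have x: "x = lvert g (n + k) c"
    using c g by (simp add: lvert_shift)
  obtain h' j where h': "h' \<in> carrier \<Gamma>" "L = ladder h'" "y = lvert h' j 1"
    using L(4) by (auto simp: is_rung_middle_of_def mid_vertex_eq)
  obtain m :: int where "h' = g \<otimes>\<^bsub>\<Gamma>\<^esub> p [^]\<^bsub>\<Gamma>\<^esub> m"
    using ladder_base_unique g h' by metis
  then have "y = lvert g (m + j) 1"
    using h' g by (simp add: lvert_shift)
  then show "infinite (sym_diff (ray_bundle X x \<gamma>) (ray_bundle X y \<gamma>))"
    unfolding x using infinite_sym_diff g \<epsilon> boundary c by metis
qed

end
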